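(* Let $X=\mathbb{R}$, let $T\colon X\to X$ be nonexpansive, and let $v := P_{\overline{\operatorname{ran}}(\operatorname{Id}-T)}0$. Suppose that $v\neq 0$ and that $\operatorname{Fix}(v+T)\neq\varnothing$. Then for every $x\in X$, the sequence $(T^n x+nv)_{n\in\mathbb{N}}$ is convergent.
   Context: $T$ is nonexpansive if $\|Tx-Ty\|\le\|x-y\|$ for all $x,y\in X$. For nonexpansive $T$, the set $\overline{\operatorname{ran}}(\operatorname{Id}-T)$ (the closure of the range of $\operatorname{Id}-T$) is known to be nonempty, closed and convex, so $v$, the projection of $0$ onto this set (its element of minimal norm), is well defined. $\operatorname{Fix}(v+T):=\{x\in X : x=v+Tx\}$. *)

theory Defs
  imports "HOL-Analysis.Analysis"
begin

definition nonexpansive :: "('a::real_normed_vector \<Rightarrow> 'a) \<Rightarrow> bool" where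
  "nonexpansive T \<longleftrightarrow> (\<forall>x y. norm (T x - T y) \<le> norm (x - y))"

(* closest_point S a is unspecified unless S is closed and nonempty, and it is unique only for
   convex S; for nonexpansive T the set closure (range (\<lambda>x. x - T x)) has all three properties. *)
definition min_displacement :: "('a::euclidean_space \<Rightarrow> 'a) \<Rightarrow> 'a" where
  "min_displacement T = closest_point (closure (range (\<lambda>x. x - T x))) 0"

definition Fix :: "('a \<Rightarrow> 'a) \<Rightarrow> 'a set" where
  "Fix S = {x. x = S x}"

end

(* On the real line the displacement x - T x is nondecreasing in x, and all its values lie on the
   side of v away from 0. So beyond a fixed point of v + T, in the direction -v, the displacement
   equals v. Each step of T moves by at least the length of v in that direction, hence every orbit
   enters this half-line, after which T^n x + n v is constant. *)
theory Submission
  imports Defs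
begin

lemma nonexpansive_continuous_on:
  assumes "nonexpansive T"
  shows "continuous_on S T"
proof -
  have "1-lipschitz_on S T"
    using assms by (intro lipschitz_onI) (auto simp: nonexpansive_def dist_norm)
  then show ?thesis
    by (rule lipschitz_on_continuous_on)
qed

lemma nonexpansive_displacement_mono:
  fixes T :: "real \<Rightarrow> real"
  assumes "nonexpansive T" and "x \<le> y"
  shows "x - T x \<le> y - T y"
proof -
  have "\<bar>T x - T y\<bar> \<le> \<bar>x - y\<bar>"
    using assms(1) by (simp add: nonexpansive_def)
  with assms(2) show ?thesis by linarith
qed

text \<open>This is the obtuse-angle inequality for the projection of 0 onto the closed range of
  displacements. Convexity comes from dimension one: a continuous image of the line is connected,
  hence an interval.\<close>

lemma min_displacement_le:
  fixes T :: "real \<Rightarrow> real"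
  assumes "nonexpansive T"
  shows "min_displacement T * min_displacement T \<le> min_displacement T * (x - T x)"
proof -
  let ?R = "range (\<lambda>x. x - T x)"
  have "connected ?R"
    by (intro connected_continuous_image continuous_intros nonexpansive_continuous_on assms) simp
  then have "convex (closure ?R)"
    by (intro convex_closure) (simp add: is_interval_connected_1 flip: is_interval_convex_1)
  moreover have "x - T x \<in> closure ?R"
    using closure_subset by fastforce
  ultimately have "inner (0 - min_displacement T) (x - T x - min_displacement T) \<le> 0"
    unfolding min_displacement_def by (intro closest_point_dot) auto
  then show ?thesis by (simp add: algebra_simps)
qed

text \<open>The displacement at \<open>x\<close> is squeezed: the projection inequality bounds it
  from one side, monotonicity against \<open>f\<close> from the other. The factor \<open>v\<close>
  lets one statement cover both signs of \<open>v\<close>.\<close>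

lemma displacement_eq_min_displacement:
  fixes T :: "real \<Rightarrow> real"
  assumes "nonexpansive T" and "v = min_displacement T" and "v \<noteq> 0"
    and "f - T f = v" and "v * x \<le> v * f"
  shows "T x = x - v"
proof -
  have "v * v \<le> v * (x - T x)"
    using min_displacement_le[OF assms(1)] assms(2) by simp
  moreover have "v * (x - T x) \<le> v * (f - T f)"
  \<comment> \<open>For negative \<open>v\<close> the order of \<open>x\<close> and \<open>f\<close>
    flips, and so does multiplication by \<open>v\<close>; the two reversals cancel.\<close>
  proof (cases "v > 0")
    case True
    with assms(5) have "x \<le> f" by simp
    with True show ?thesis
      by (intro mult_left_mono nonexpansive_displacement_mono assms(1)) auto
  next
    case False
    with assms(3,5) have "f \<le> x" by (simp add: mult_le_cancel_left)
    with False show ?thesis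
      by (intro mult_left_mono_neg nonexpansive_displacement_mono assms(1)) auto
  qed
  ultimately have "v * (x - T x) = v * v"
    using assms(4) by simp
  with assms(3) show ?thesis by simp
qed

theorem theorem3p6:
  fixes T :: "real \<Rightarrow> real" and v :: real
  assumes "nonexpansive T"
    and "v = min_displacement T"
    and "v \<noteq> 0"
    and "Fix (\<lambda>x. v + T x) \<noteq> {}"
  shows "\<forall>x. convergent (\<lambda>n. (T ^^ n) x + real n * v)"
proof
  fix x
  obtain f where "f = v + T f"
    using assms(4) by (auto simp: Fix_def)
  then have f: "f - T f = v" by linarith
  have step: "v * T y \<le> v * y - v * v" for y
    using min_displacement_le[OF assms(1), of y] assms(2) by (simp add: algebra_simps)
  have orbit: "v * (T ^^ n) x \<le> v * x - real n * (v * v)" for n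
  proof (induction n)
    case (Suc n)
    with step[of "(T ^^ n) x"] show ?case by (simp add: algebra_simps)
  qed simp
  have "0 < v * v"
    using assms(3) by (auto simp: zero_less_mult_iff)
  \<comment> \<open>\<open>N\<close> is chosen so that the bound \<open>orbit\<close> lies below
    \<open>v * f\<close> from index \<open>N\<close> on.\<close>
  then obtain N where N: "v * x - v * f < real N * (v * v)"
    using reals_Archimedean3 by blast
  have const: "(T ^^ (N + k)) x = (T ^^ N) x - real k * v" for k
  proof (induction k)
    case (Suc k)
    have "real N * (v * v) \<le> real (N + k) * (v * v)"
      by (intro mult_right_mono) auto
    with orbit[of "N + k"] N have "v * (T ^^ (N + k)) x \<le> v * f" by linarith
    then have "T ((T ^^ (N + k)) x) = (T ^^ (N + k)) x - v"
      by (rule displacement_eq_min_displacement[OF assms(1-3) f])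
    with Suc show ?case by (simp add: algebra_simps)
  qed simp
  \<comment> \<open>Each further step subtracts exactly \<open>v\<close>, which the added multiple
    of \<open>v\<close> compensates.\<close>
  have "(T ^^ (k + N)) x + real (k + N) * v = (T ^^ N) x + real N * v" for k
    using const[of k] by (simp add: add.commute[of k] algebra_simps)
  then have "convergent (\<lambda>k. (T ^^ (k + N)) x + real (k + N) * v)"
    by (simp add: convergent_const)
  then show "convergent (\<lambda>n. (T ^^ n) x + real n * v)"
    by (rule convergent_ignore_initial_segment[THEN iffD1])
qed

end
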